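(* For $n\ge 1$ let $C(n)$ denote the number of minimum locating-dominating codes in the path $P_n$. Then for every integer $m\ge 1$: \begin{itemize} \item $C(5m)=1$; \item $C(5m+1)=\frac{1}{6}m^3+2m^2+\frac{29}{6}m+1$; \item $C(5m+2)=m+2$; \item $C(5m+3)=\frac{1}{24}m^4+\frac{11}{12}m^3+\frac{131}{24}m^2+\frac{103}{12}m+3$; \item $C(5m+4)=\frac{1}{2}m^2+\frac{7}{2}m+4$. \end{itemize}
   Context: $P_n$ is the path with vertex set $\{v_1,\dots,v_n\}$ and edges $v_iv_{i+1}$ for $1\le i\le n-1$. For a graph $G$, $N_G[v]$ denotes the closed neighbourhood of $v$ (the vertex $v$ together with its neighbours), and for $S\subseteq V(G)$ put $I_G(S;v)=S\cap N_G[v]$. A nonempty set $S\subseteq V(G)$ is a locating-dominating code if for all distinct $x,y\in V(G)\setminus S$ we have $I_G(S;x)\ne I_G(S;y)$, and $I_G(S;x)\neq\emptyset$ for every $x\in V(G)\setminus S$. A minimum locating-dominating code is one of smallest possible cardinality in $G$. Codes are counted as subsets of the labelled vertex set (not up to automorphism). *)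

theory Defs
  imports Complex_Main
begin

text \<open>A finite simple graph is given by its vertex set and its edge set, whose members
  are two-element sets of vertices.\<close>

definition closed_nbhd :: "'a set \<Rightarrow> 'a set set \<Rightarrow> 'a \<Rightarrow> 'a set" where
  "closed_nbhd V E v = insert v {u \<in> V. {u, v} \<in> E}"

definition ident_set :: "'a set \<Rightarrow> 'a set set \<Rightarrow> 'a set \<Rightarrow> 'a \<Rightarrow> 'a set" where
  "ident_set V E S v = S \<inter> closed_nbhd V E v"

definition locating_dominating_code :: "'a set \<Rightarrow> 'a set set \<Rightarrow> 'a set \<Rightarrow> bool" where
  "locating_dominating_code V E S \<longleftrightarrow>
     S \<noteq> {} \<and> S \<subseteq> V \<and>
     (\<forall>x \<in> V - S. \<forall>y \<in> V - S. x \<noteq> y \<longrightarrow> ident_set V E S x \<noteq> ident_set V E S y) \<and>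
     (\<forall>x \<in> V - S. ident_set V E S x \<noteq> {})"

definition minimum_ld_code :: "'a set \<Rightarrow> 'a set set \<Rightarrow> 'a set \<Rightarrow> bool" where
  "minimum_ld_code V E S \<longleftrightarrow>
     locating_dominating_code V E S \<and>
     (\<forall>T. locating_dominating_code V E T \<longrightarrow> card S \<le> card T)"

text \<open>The vertex \<open>v\<^sub>i\<close> of the path is represented by its index \<open>i\<close>.\<close>

definition path_verts :: "nat \<Rightarrow> nat set" where
  "path_verts n = {1..n}"

definition path_edges :: "nat \<Rightarrow> nat set set" where
  "path_edges n = {{i, i + 1} | i. 1 \<le> i \<and> i < n}"

definition num_min_ld_codes_path :: "nat \<Rightarrow> nat" where
  "num_min_ld_codes_path n = card {S. minimum_ld_code (path_verts n) (path_edges n) S}"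

end

theory Submission
  imports Defs
begin

text \<open>
  Write a set \<open>S\<close> of vertices of the path as the 0-1 word of its characteristic function
  (\<open>True\<close> for a code vertex). Two non-code vertices of a path can have the same nonempty
  identifying set only if they are the two neighbours of a code vertex and neither has another
  code neighbour. Hence \<open>S\<close> is a locating-dominating code exactly if its word, padded
  by one 0 at each end, contains neither \<open>000\<close> (an undominated vertex in the middle) nor
  \<open>00100\<close> (two vertices that are not separated). This is
  \<open>locating_dominating_path_iff_avoiding\<close>, and it turns the problem into counting words by their
  length \<open>n\<close> and their number \<open>k\<close> of ones.

  Let \<open>E(n,k)\<close> count the words that may follow a 1 which is not preceded by \<open>00\<close>, and let
  \<open>A(n,k)\<close> count those that may follow the initial padding 0; \<open>A(n,k)\<close> is the number of codes
  with \<open>k\<close> elements. Cutting a word at its next such 1 gives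
    \<open>E(n+5,k+2) = E(n+4,k+1) + E(n+3,k+1) + E(n+1,k) + E(n,k)\<close> and
    \<open>A(n+4,k+2) = E(n+3,k+1) + E(n+1,k) + E(n,k)\<close>.

  The point is to look at the excess \<open>5k - 2n\<close>. The four terms on the right of the first
  recurrence have an excess that is smaller than that of the left by 3, 1, 2 and 0,
  respectively. Moreover \<open>E(n,k) = 0\<close> if the excess is below \<open>-2\<close> and \<open>A(n,k) = 0\<close> if it is
  negative (\<open>avoiding_density\<close>). So, along \<open>n \<mapsto> n+5\<close>, \<open>k \<mapsto> k+2\<close>, each \<open>E\<close> of fixed excess is the
  summatory function of those of smaller excess, that is, a polynomial whose degree goes up
  by one with each unit of excess, starting from the constant 1 at excess \<open>-2\<close>. A code of
  minimum size has \<open>k = \<lceil>2n/5\<rceil>\<close>, hence excess 0, 3, 1, 4, 2 for \<open>n \<equiv> 0, 1, 2, 3, 4\<close> modulo 5,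
  and the recurrence for \<open>A\<close> expresses its count by the polynomials for \<open>E\<close> of excess at most 2.
\<close>

section \<open>Codes in a path as words with two forbidden factors\<close>

fun avoiding :: "bool list \<Rightarrow> bool" where
  "avoiding [] \<longleftrightarrow> True"
| "avoiding (x # xs) \<longleftrightarrow>
     take 3 (x # xs) \<noteq> [False, False, False] \<and>
     take 5 (x # xs) \<noteq> [False, False, True, False, False] \<and> avoiding xs"

lemma avoiding_map_upt:
  "avoiding (map f [a..<b]) \<longleftrightarrow>
     (\<forall>i\<ge>a. i + 2 < b \<longrightarrow> f i \<or> f (i + 1) \<or> f (i + 2)) \<and>
     (\<forall>i\<ge>a. i + 4 < b \<longrightarrow> \<not> (\<not> f i \<and> \<not> f (i + 1) \<and> f (i + 2) \<and> \<not> f (i + 3) \<and> \<not> f (i + 4)))"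
    (is "_ \<longleftrightarrow> (\<forall>i\<ge>a. ?P i) \<and> (\<forall>i\<ge>a. ?Q i)")
proof (induction "b - a" arbitrary: a)
  case 0
  then show ?case by auto
next
  case (Suc d)
  have split: "(\<forall>i\<ge>a. P i) \<longleftrightarrow> P a \<and> (\<forall>i\<ge>Suc a. P i)" for P :: "nat \<Rightarrow> bool"
    unfolding Suc_le_eq le_less[of a] by auto
  have upt: "[a..<b] = a # [Suc a..<b]"
    using Suc.hyps(2) by (simp add: upt_conv_Cons)
  have three: "take 3 (map f [a..<b]) \<noteq> [False, False, False] \<longleftrightarrow> ?P a"
  proof (cases "a + 2 < b")
    case True
    then have "take 3 (map f [a..<b]) = map f [a..<a + 3]"
      by (simp add: take_map)
    also have "[a..<a + 3] = [a, a + 1, a + 2]"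
      by (simp add: upt_rec[of a] upt_rec[of "Suc _"] eval_nat_numeral)
    finally show ?thesis using True by simp
  next
    case False
    then have "length (take 3 (map f [a..<b])) \<noteq> 3" by simp
    then show ?thesis using False by (auto dest: arg_cong[of _ _ length])
  qed
  have five: "take 5 (map f [a..<b]) \<noteq> [False, False, True, False, False] \<longleftrightarrow> ?Q a"
  proof (cases "a + 4 < b")
    case True
    then have "take 5 (map f [a..<b]) = map f [a..<a + 5]"
      by (simp add: take_map)
    also have "[a..<a + 5] = [a, a + 1, a + 2, a + 3, a + 4]"
      by (simp add: upt_rec[of a] upt_rec[of "Suc _"] eval_nat_numeral)
    finally show ?thesis using True by simp
  next
    case False
    then have "length (take 5 (map f [a..<b])) \<noteq> 5" by simp
    then show ?thesis using False by (auto dest: arg_cong[of _ _ length])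
  qed
  have IH: "avoiding (map f [Suc a..<b]) \<longleftrightarrow> (\<forall>i\<ge>Suc a. ?P i) \<and> (\<forall>i\<ge>Suc a. ?Q i)"
    using Suc.hyps(2) by (intro Suc.hyps(1)) simp
  have "avoiding (map f [a..<b]) \<longleftrightarrow> take 3 (map f [a..<b]) \<noteq> [False, False, False] \<and>
     take 5 (map f [a..<b]) \<noteq> [False, False, True, False, False] \<and> avoiding (map f [Suc a..<b])"
    unfolding upt by simp
  also have "\<dots> \<longleftrightarrow> (?P a \<and> (\<forall>i\<ge>Suc a. ?P i)) \<and> (?Q a \<and> (\<forall>i\<ge>Suc a. ?Q i))"
    unfolding three five IH by (simp only: conj_ac)
  also have "\<dots> \<longleftrightarrow> (\<forall>i\<ge>a. ?P i) \<and> (\<forall>i\<ge>a. ?Q i)"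
    unfolding split[of ?P] split[of ?Q] by (rule refl)
  finally show ?case .
qed

lemma mem_ident_set_path:
  assumes "S \<subseteq> path_verts n" "x \<in> path_verts n"
  shows "u \<in> ident_set (path_verts n) (path_edges n) S x \<longleftrightarrow> u \<in> S \<and> (u = x \<or> u = x + 1 \<or> x = u + 1)"
  using assms
  unfolding ident_set_def closed_nbhd_def path_edges_def path_verts_def
  by (auto simp: doubleton_eq_iff) force+

text \<open>The padding positions 0 and \<open>n + 1\<close> are never in \<open>S\<close>, so they stand for missing neighbours and
  the end vertices need no separate treatment. Domination of vertex \<open>i + 1\<close> excludes \<open>000\<close> at
  position \<open>i\<close>. If distinct non-code vertices share a nonempty identifying set, they have a
  common code neighbour, so they are \<open>i + 1\<close> and \<open>i + 3\<close> around the code vertex \<open>i + 2\<close>, and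
  neither \<open>i\<close> nor \<open>i + 4\<close> may be a code vertex, since it would be seen by only one of them.\<close>

lemma locating_dominating_path_iff_avoiding:
  assumes "n \<ge> 1" and S: "S \<subseteq> path_verts n"
  shows "locating_dominating_code (path_verts n) (path_edges n) S \<longleftrightarrow>
     avoiding (map (\<lambda>i. i \<in> S) [0..<n + 2])"
    (is "?L \<longleftrightarrow> ?R")
proof -
  let ?V = "path_verts n"
  let ?I = "ident_set ?V (path_edges n) S"
  note mem = mem_ident_set_path[OF S]
  have R: "?R \<longleftrightarrow>
     (\<forall>i. i < n \<longrightarrow> i \<in> S \<or> i + 1 \<in> S \<or> i + 2 \<in> S) \<and>
     (\<forall>i. i + 2 < n \<longrightarrow> \<not> (i \<notin> S \<and> i + 1 \<notin> S \<and> i + 2 \<in> S \<and> i + 3 \<notin> S \<and> i + 4 \<notin> S))"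
    unfolding avoiding_map_upt by simp
  have dom: "(\<forall>x\<in>?V - S. ?I x \<noteq> {}) \<longleftrightarrow> (\<forall>i. i < n \<longrightarrow> i \<in> S \<or> i + 1 \<in> S \<or> i + 2 \<in> S)"
  proof (intro iffI allI impI ballI)
    fix i assume *: "\<forall>x\<in>?V - S. ?I x \<noteq> {}" and "i < n"
    then have V: "i + 1 \<in> ?V" by (simp add: path_verts_def)
    show "i \<in> S \<or> i + 1 \<in> S \<or> i + 2 \<in> S"
    proof (cases "i + 1 \<in> S")
      case False
      with * V obtain u where "u \<in> ?I (i + 1)" by blast
      then show ?thesis using mem[OF V] by auto
    qed simp
  next
    fix x assume *: "\<forall>i. i < n \<longrightarrow> i \<in> S \<or> i + 1 \<in> S \<or> i + 2 \<in> S" and x: "x \<in> ?V - S"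
    then obtain i where i: "x = i + 1" "i < n"
      by (cases x) (auto simp: path_verts_def)
    with * have "i \<in> S \<or> i + 1 \<in> S \<or> i + 2 \<in> S" by blast
    moreover have "x \<in> ?V" using x by simp
    ultimately show "?I x \<noteq> {}" using mem[of x] i by auto
  qed
  have loc: "(\<forall>x\<in>?V - S. \<forall>y\<in>?V - S. x \<noteq> y \<longrightarrow> ?I x \<noteq> ?I y) \<longleftrightarrow>
     (\<forall>i. i + 2 < n \<longrightarrow> \<not> (i \<notin> S \<and> i + 1 \<notin> S \<and> i + 2 \<in> S \<and> i + 3 \<notin> S \<and> i + 4 \<notin> S))"
    if dom': "\<forall>x\<in>?V - S. ?I x \<noteq> {}"
  proof (intro iffI allI impI ballI notI)
    fix i assume *: "\<forall>x\<in>?V - S. \<forall>y\<in>?V - S. x \<noteq> y \<longrightarrow> ?I x \<noteq> ?I y" and i: "i + 2 < n"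
      and pat: "i \<notin> S \<and> i + 1 \<notin> S \<and> i + 2 \<in> S \<and> i + 3 \<notin> S \<and> i + 4 \<notin> S"
    have V: "i + 1 \<in> ?V" "i + 3 \<in> ?V" using i by (auto simp: path_verts_def)
    have "?I (i + 1) = {i + 2}"
      unfolding set_eq_iff mem[OF V(1)] using pat by auto
    moreover have "?I (i + 3) = {i + 2}"
      unfolding set_eq_iff mem[OF V(2)] using pat by (auto simp: numeral_eq_Suc)
    moreover have "i + 1 \<in> ?V - S" "i + 3 \<in> ?V - S" "i + 1 \<noteq> i + 3"
      using V pat by auto
    ultimately show False using * by metis
  next
    fix x y
    assume *: "\<forall>i. i + 2 < n \<longrightarrow> \<not> (i \<notin> S \<and> i + 1 \<notin> S \<and> i + 2 \<in> S \<and> i + 3 \<notin> S \<and> i + 4 \<notin> S)"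
      and xy: "x \<in> ?V - S" "y \<in> ?V - S" "x \<noteq> y" "?I x = ?I y"
    \<comment> \<open>By symmetry it is enough to exclude a pair listed in increasing order.\<close>
    have no: False if "x < y" "x \<in> ?V - S" "y \<in> ?V - S" "?I x = ?I y" for x y
    proof -
      have V: "x \<in> ?V" "y \<in> ?V" using that by auto
      have "?I x \<noteq> {}" using dom' that(2) by blast
      then obtain u where "u \<in> ?I x" by blast
      with that(4) have "u \<in> ?I x" "u \<in> ?I y" by simp_all
      then have y: "u = x + 1" "y = x + 2" "x + 1 \<in> S"
        using that unfolding mem[OF V(1)] mem[OF V(2)] by auto
      obtain i where i: "x = i + 1" using V by (cases x) (auto simp: path_verts_def)
      have same: "u \<in> S \<and> (u = x \<or> u = x + 1 \<or> x = u + 1) \<longleftrightarrow>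
          u \<in> S \<and> (u = y \<or> u = y + 1 \<or> y = u + 1)" for u
        using that(4) unfolding set_eq_iff mem[OF V(1)] mem[OF V(2)] by blast
      have "i \<notin> S" using same[of i] y i by auto
      moreover have "i + 4 \<notin> S" using same[of "i + 4"] y i by auto
      moreover have "i + 1 \<notin> S" "i + 2 \<in> S" "i + 3 \<notin> S"
        using y i that by (auto simp: numeral_eq_Suc)
      moreover have "i + 2 < n" using V y i by (auto simp: path_verts_def)
      ultimately show False using * by blast
    qed
    show False using no[of x y] no[of y x] xy by (metis linorder_neqE_nat)
  qed
  have ne: "S \<noteq> {}" if "\<forall>x\<in>?V - S. ?I x \<noteq> {}"
  proof
    assume "S = {}"
    moreover have "1 \<in> ?V" using assms(1) by (simp add: path_verts_def)
    ultimately show False using that by (auto simp: ident_set_def)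
  qed
  show ?thesis
  proof (cases "\<forall>x\<in>?V - S. ?I x \<noteq> {}")
    case True
    have "?L \<longleftrightarrow> (\<forall>x\<in>?V - S. \<forall>y\<in>?V - S. x \<noteq> y \<longrightarrow> ?I x \<noteq> ?I y)"
      unfolding locating_dominating_code_def
      by (insert True ne[OF True] S, rule iffI, elim conjE, assumption, intro conjI, assumption+)
    also have "\<dots> \<longleftrightarrow> ?R"
      unfolding R dom[symmetric] loc[OF True]
      by (insert True, rule iffI, rule conjI, assumption+, elim conjE, assumption)
    finally show ?thesis .
  next
    case False
    then show ?thesis
      unfolding locating_dominating_code_def R dom[symmetric] by (simp only: simp_thms)
  qed
qed

section \<open>Counting the continuations of a prefix\<close>

text \<open>The prefix \<open>p\<close> carries the left padding and all letters already fixed; the trailing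
  \<open>False\<close> is the right padding.\<close>

definition completions :: "bool list \<Rightarrow> nat \<Rightarrow> nat \<Rightarrow> bool list set" where
  "completions p n k =
     {w. length w = n \<and> count_list w True = k \<and> avoiding (p @ w @ [False])}"

lemma finite_completions [simp]: "finite (completions p n k)"
proof (rule finite_subset)
  show "completions p n k \<subseteq> {w. set w \<subseteq> UNIV \<and> length w = n}"
    by (auto simp: completions_def)
qed (rule finite_lists_length_eq, simp)

lemma card_completions_0:
  "card (completions p 0 k) = (if k = 0 \<and> avoiding (p @ [False]) then 1 else 0)"
proof -
  have "completions p 0 k = (if k = 0 \<and> avoiding (p @ [False]) then {[]} else {})"
    by (auto simp: completions_def)
  then show ?thesis by simp
qed

lemma completions_Suc:
  "completions p (Suc n) k =
     Cons False ` completions (p @ [False]) n k \<union>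
     Cons True ` {w \<in> completions (p @ [True]) n (k - 1). k \<noteq> 0}"
  unfolding completions_def
  by (auto simp: length_Suc_conv image_iff)

lemma card_completions_Suc_0:
  "card (completions p (Suc n) 0) = card (completions (p @ [False]) n 0)"
  by (simp add: completions_Suc card_image)

lemma card_completions_Suc_Suc:
  "card (completions p (Suc n) (Suc k)) =
     card (completions (p @ [False]) n (Suc k)) + card (completions (p @ [True]) n k)"
  unfolding completions_Suc
  by (subst card_Un_disjoint) (auto simp: card_image)

text \<open>Both forbidden factors begin with 00, and neither contains 11 or 101. So the constraints on
  the rest of the word depend only on a short suffix of what precedes it: only the prefixes 1, 0, 00, 001 and 0010 remain.\<close>

lemma completions_reduce:
  "completions [True, False] = completions [False]"
  "completions [True, True] = completions [True]"
  "completions [False, True] = completions [True]"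
  "completions [False, False, True, True] = completions [True]"
  "completions [False, False, True, False, True] = completions [True]"
  by (intro ext, simp add: completions_def)+

lemma completions_dead:
  "completions [False, False, False] n k = {}"
  "completions [False, False, True, False, False] n k = {}"
  by (simp_all add: completions_def)

lemmas card_completions_simps = card_completions_0 card_completions_Suc_0
  card_completions_Suc_Suc completions_reduce completions_dead

text \<open>The next 1 after which everything is again unconstrained comes at the end of one of the blocks
  1, 01, 0011, 00101, which have lengths 1, 2, 4, 5 and contain 1, 1, 2, 2 ones.\<close>

lemma completions_True_rec:
  "card (completions [True] (n + 5) (k + 2)) =
     card (completions [True] (n + 4) (k + 1)) + card (completions [True] (n + 3) (k + 1)) +
     card (completions [True] (n + 1) k) + card (completions [True] n k)"
  by (simp add: card_completions_simps eval_nat_numeral del: card_0_eq)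

text \<open>The given 0 is the first letter of the blocks 01, 0011 and 00101, so only
  1, 011 and 0101 remain of them.\<close>

lemma completions_False_rec:
  "card (completions [False] (n + 4) (k + 2)) =
     card (completions [True] (n + 3) (k + 1)) +
     card (completions [True] (n + 1) k) + card (completions [True] n k)"
  by (simp add: card_completions_simps eval_nat_numeral del: card_0_eq)

section \<open>The density bound\<close>

text \<open>Every letter 0 costs 2 units and every letter 1 earns 3. The bound holds with a constant that
  depends on the prefix: the constants \<open>2, 0, -2, 1, -1\<close> are chosen so that the induction over
  the word closes for all five prefixes at once. The case of the prefix 0 is the lower bound
  \<open>2n/5\<close> for the size of a code.\<close>

lemma avoiding_density:
  shows "avoiding (True # w @ [False]) \<Longrightarrow> 2 * length w \<le> 5 * count_list w True + 2"
    and "avoiding (False # w @ [False]) \<Longrightarrow> 2 * length w \<le> 5 * count_list w True"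
    and "avoiding (False # False # w @ [False]) \<Longrightarrow> 2 * length w + 2 \<le> 5 * count_list w True"
    and "avoiding (False # False # True # w @ [False]) \<Longrightarrow> 2 * length w \<le> 5 * count_list w True + 1"
    and "avoiding (False # False # True # False # w @ [False]) \<Longrightarrow>
           2 * length w + 1 \<le> 5 * count_list w True"
proof (induction w)
  case Nil
  { case 1 then show ?case by simp }
  { case 2 then show ?case by simp }
  { case 3 then show ?case by simp }
  { case 4 then show ?case by simp }
  { case 5 then show ?case by simp }
next
  case (Cons x w)
  { case 1 then show ?case using Cons.IH by (cases x) auto }
  { case 2 then show ?case using Cons.IH by (cases x) auto }
  { case 3 then show ?case using Cons.IH by (cases x) auto }
  { case 4 then show ?case using Cons.IH by (cases x) auto }
  { case 5 then show ?case using Cons.IH by (cases x) auto }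
qed

lemma completions_True_empty:
  "5 * k + 2 < 2 * n \<Longrightarrow> completions [True] n k = {}"
  using avoiding_density(1) by (fastforce simp: completions_def)

lemma completions_False_empty:
  "5 * k < 2 * n \<Longrightarrow> completions [False] n k = {}"
  using avoiding_density(2) by (fastforce simp: completions_def)

section \<open>Closed forms along lines of constant excess\<close>

text \<open>The next five lemmas treat the excess \<open>5k - 2n = -2, -1, 0, 1, 2\<close>. In each of them the recurrence
  expresses the increment from \<open>m\<close> to \<open>m + 1\<close> by the closed forms for smaller excess, while the
  terms of excess below \<open>-2\<close> vanish.\<close>

lemma card_completions_True_deficit2:
  "card (completions [True] (5 * m + 1) (2 * m)) = 1"
proof (induction m)
  case 0
  show ?case by (simp add: card_completions_simps)
next
  case (Suc m)
  then show ?case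
    using completions_True_rec[of "5 * m + 1" "2 * m"] by (simp add: completions_True_empty ac_simps)
qed

lemma card_completions_True_deficit1:
  "card (completions [True] (5 * m + 3) (2 * m + 1)) = m + 2"
proof (induction m)
  case 0
  show ?case by (simp add: card_completions_simps eval_nat_numeral)
next
  case (Suc m)
  then show ?case
    using completions_True_rec[of "5 * m + 3" "2 * m + 1"] card_completions_True_deficit2[of "Suc m"]
    by (simp add: completions_True_empty ac_simps)
qed

lemma card_completions_True_excess0:
  "real (card (completions [True] (5 * m) (2 * m))) = 1/2 * real m ^ 2 + 5/2 * real m + 1"
proof (induction m)
  case 0
  show ?case by (simp add: card_completions_simps)
next
  case (Suc m)
  have "card (completions [True] (5 * Suc m) (2 * Suc m)) =
      card (completions [True] (5 * m) (2 * m)) + m + 3"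
    using completions_True_rec[of "5 * m" "2 * m"] card_completions_True_deficit1[of m]
      card_completions_True_deficit2[of m]
    by (simp add: completions_True_empty ac_simps)
  then show ?case using Suc by (simp add: power2_eq_square field_simps)
qed

lemma card_completions_True_excess1:
  "real (card (completions [True] (5 * m + 2) (2 * m + 1))) =
     1/6 * real m ^ 3 + 2 * real m ^ 2 + 29/6 * real m + 2"
proof (induction m)
  case 0
  show ?case by (simp add: card_completions_simps eval_nat_numeral)
next
  case (Suc m)
  have "card (completions [True] (5 * Suc m + 2) (2 * Suc m + 1)) =
      card (completions [True] (5 * m + 2) (2 * m + 1)) +
      card (completions [True] (5 * Suc m) (2 * Suc m)) + m + 3"
    using completions_True_rec[of "5 * m + 2" "2 * m + 1"] card_completions_True_deficit1[of m]
      card_completions_True_deficit2[of "Suc m"]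
    by (simp add: eval_nat_numeral)
  then show ?case using Suc card_completions_True_excess0[of "Suc m"]
    by (simp add: power2_eq_square power3_eq_cube field_simps)
qed

lemma card_completions_True_excess2:
  "real (card (completions [True] (5 * m + 4) (2 * m + 2))) =
     1/24 * real m ^ 4 + 11/12 * real m ^ 3 + 131/24 * real m ^ 2 + 115/12 * real m + 5"
proof (induction m)
  case 0
  show ?case by (simp add: card_completions_simps eval_nat_numeral)
next
  case (Suc m)
  have "card (completions [True] (5 * Suc m + 4) (2 * Suc m + 2)) =
      card (completions [True] (5 * m + 4) (2 * m + 2)) +
      card (completions [True] (5 * Suc m + 2) (2 * Suc m + 1)) +
      card (completions [True] (5 * Suc m) (2 * Suc m)) + m + 3"
    using completions_True_rec[of "5 * m + 4" "2 * m + 2"] card_completions_True_deficit1[of "Suc m"]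
    by (simp add: ac_simps)
  then show ?case using Suc card_completions_True_excess0[of "Suc m"]
      card_completions_True_excess1[of "Suc m"]
    by (simp add: power2_eq_square power3_eq_cube power4_eq_xxxx field_simps)
qed

section \<open>Minimum codes\<close>

lemma bij_betw_ld_codes_completions:
  assumes "n \<ge> 1"
  shows "bij_betw (\<lambda>S. map (\<lambda>i. i \<in> S) [1..<Suc n])
     {S. locating_dominating_code (path_verts n) (path_edges n) S \<and> card S = k}
     (completions [False] n k)"
proof (rule bij_betw_imageI)
  let ?w = "\<lambda>S::nat set. map (\<lambda>i. i \<in> S) [1..<Suc n]"
  let ?C = "{S. locating_dominating_code (path_verts n) (path_edges n) S \<and> card S = k}"
  have sub: "S \<subseteq> {1..n}" if "S \<in> ?C" for S
    using that by (auto simp: locating_dominating_code_def path_verts_def)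
  have pad: "map (\<lambda>i. i \<in> S) [0..<n + 2] = [False] @ ?w S @ [False]" if "S \<subseteq> {1..n}" for S
  proof -
    have "[0..<n + 2] = [0] @ [1..<Suc n] @ [Suc n]"
      using assms by (simp add: upt_conv_Cons)
    then show ?thesis using that by (auto simp del: upt_Suc)
  qed
  have count: "count_list (?w S) True = card S" if "S \<subseteq> {1..n}" for S
  proof -
    have "count_list (?w S) True = length (filter (\<lambda>i. i \<in> S) [1..<Suc n])"
      by (simp add: count_list_eq_length_filter filter_map o_def)
    also have "\<dots> = card (set (filter (\<lambda>i. i \<in> S) [1..<Suc n]))"
      by (rule distinct_card[symmetric]) simp
    also have "set (filter (\<lambda>i. i \<in> S) [1..<Suc n]) = S"
      using that by auto
    finally show ?thesis .
  qed
  have code: "S \<in> ?C \<longleftrightarrow> ?w S \<in> completions [False] n k" if "S \<subseteq> {1..n}" for S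
  proof -
    have "?w S \<in> completions [False] n k \<longleftrightarrow> card S = k \<and> avoiding ([False] @ ?w S @ [False])"
      unfolding completions_def mem_Collect_eq count[OF that] by simp
    then show ?thesis
      using locating_dominating_path_iff_avoiding[OF assms, of S] that
      unfolding pad[OF that] path_verts_def by blast
  qed
  show "inj_on ?w ?C"
  proof (rule inj_onI)
    fix S T assume "S \<in> ?C" "T \<in> ?C" "?w S = ?w T"
    then have "i \<in> S \<longleftrightarrow> i \<in> T" if "i \<in> {1..n}" for i
      using that by (auto simp: map_eq_conv simp del: upt_Suc)
    then show "S = T" using sub \<open>S \<in> ?C\<close> \<open>T \<in> ?C\<close> by blast
  qed
  show "?w ` ?C = completions [False] n k"
  proof (intro equalityI subsetI)
    fix w assume "w \<in> ?w ` ?C"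
    then show "w \<in> completions [False] n k" using code sub by blast
  next
    fix w assume w: "w \<in> completions [False] n k"
    let ?S = "{i \<in> {1..n}. w ! (i - 1)}"
    have eq: "?w ?S = w"
      using w by (intro nth_equalityI) (auto simp: completions_def simp del: upt_Suc)
    have "?S \<subseteq> {1..n}" by blast
    note code = code[OF this]
    have "?S \<in> ?C" unfolding code eq by (rule w)
    then show "w \<in> ?w ` ?C" using eq by (rule rev_image_eqI[OF _ sym])
  qed
qed

text \<open>The density bound forces \<open>2n \<le> 5k\<close> for the size \<open>k\<close> of any code. If a code of size
  \<open>k < 2n/5 + 1\<close> exists, no smaller size is possible.\<close>

lemma num_min_ld_codes_path_eq:
  assumes "n \<ge> 1" "5 * k < 2 * n + 5" "completions [False] n k \<noteq> {}"
  shows "num_min_ld_codes_path n = card (completions [False] n k)"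
proof -
  let ?L = "locating_dominating_code (path_verts n) (path_edges n)"
  note bij = bij_betw_ld_codes_completions[OF assms(1)]
  have lower: "k \<le> card T" if "?L T" for T
  proof -
    have "completions [False] n (card T) \<noteq> {}"
      using bij_betwE[OF bij[of "card T"]] that by blast
    then have "2 * n \<le> 5 * card T"
      using completions_False_empty[of "card T" n] by linarith
    then show ?thesis using assms(2) by linarith
  qed
  have "{S. ?L S \<and> card S = k} \<noteq> {}"
    using bij[of k] assms(3) by (metis bij_betw_empty1)
  then obtain S where "?L S" "card S = k" by blast
  then have "{S. minimum_ld_code (path_verts n) (path_edges n) S} = {S. ?L S \<and> card S = k}"
    using lower by (auto simp: minimum_ld_code_def intro: antisym)
  then show ?thesis
    using bij_betw_same_card[OF bij[of k]] by (simp add: num_min_ld_codes_path_def)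
qed

theorem theorem4p1:
  fixes m :: nat
  assumes "m \<ge> 1"
  shows "num_min_ld_codes_path (5 * m) = 1
    \<and> real (num_min_ld_codes_path (5 * m + 1))
        = 1 / 6 * real m ^ 3 + 2 * real m ^ 2 + 29 / 6 * real m + 1
    \<and> num_min_ld_codes_path (5 * m + 2) = m + 2
    \<and> real (num_min_ld_codes_path (5 * m + 3))
        = 1 / 24 * real m ^ 4 + 11 / 12 * real m ^ 3 + 131 / 24 * real m ^ 2
          + 103 / 12 * real m + 3
    \<and> real (num_min_ld_codes_path (5 * m + 4))
        = 1 / 2 * real m ^ 2 + 7 / 2 * real m + 4"
proof -
  obtain j where m: "m = Suc j" using assms by (cases m) auto
  let ?A = "\<lambda>n k. card (completions [False] n k)"
  let ?E = "\<lambda>n k. card (completions [True] n k)"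
  have num: "num_min_ld_codes_path n = ?A n k" if "n \<ge> 1" "5 * k < 2 * n + 5" "?A n k > 0" for n k
    using num_min_ld_codes_path_eq[OF that(1,2)] that(3) by fastforce

  \<comment> \<open>\<open>Ae\<close> is the count at excess \<open>e\<close>; terms of \<open>E\<close> with excess below \<open>-2\<close> have dropped out.\<close>
  have A0: "?A (5 * m) (2 * m) = 1"
    using completions_False_rec[of "5 * j + 1" "2 * j"] card_completions_True_deficit2[of j]
    by (simp add: m completions_True_empty ac_simps)
  have A3: "?A (5 * m + 1) (2 * m + 1) = ?E (5 * m) (2 * m) + ?E (5 * j + 2) (2 * j + 1) + j + 2"
    using completions_False_rec[of "5 * j + 2" "2 * j + 1"] card_completions_True_deficit1[of j]
    by (simp add: m eval_nat_numeral)
  have A1: "?A (5 * m + 2) (2 * m + 1) = m + 2"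
    using completions_False_rec[of "5 * j + 3" "2 * j + 1"] card_completions_True_deficit1[of j]
      card_completions_True_deficit2[of m]
    by (simp add: m completions_True_empty ac_simps)
  have A4: "?A (5 * m + 3) (2 * m + 2) =
      ?E (5 * m + 2) (2 * m + 1) + ?E (5 * m) (2 * m) + ?E (5 * j + 4) (2 * j + 2)"
    using completions_False_rec[of "5 * j + 4" "2 * j + 2"]
    by (simp add: m ac_simps)
  have A2: "?A (5 * m + 4) (2 * m + 2) = ?E (5 * m) (2 * m) + m + 3"
    using completions_False_rec[of "5 * m" "2 * m"] card_completions_True_deficit1[of m]
      card_completions_True_deficit2[of m]
    by (simp add: ac_simps)

  \<comment> \<open>The counts are positive, so these sizes are attained and hence minimum.\<close>
  have C0: "num_min_ld_codes_path (5 * m) = 1"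
    using num[of "5 * m" "2 * m"] A0 assms by simp
  have C1: "num_min_ld_codes_path (5 * m + 1) = ?A (5 * m + 1) (2 * m + 1)"
    using A3 by (intro num) simp_all
  have C2: "num_min_ld_codes_path (5 * m + 2) = m + 2"
    using num[of "5 * m + 2" "2 * m + 1"] A1 by simp
  have pos: "?E (5 * m) (2 * m) > 0"
  proof -
    have "real (?E (5 * m) (2 * m)) > 0"
      unfolding card_completions_True_excess0 by (simp add: add_nonneg_pos)
    then show ?thesis by simp
  qed
  have C3: "num_min_ld_codes_path (5 * m + 3) = ?A (5 * m + 3) (2 * m + 2)"
    using A4 pos by (intro num) simp_all
  have C4: "num_min_ld_codes_path (5 * m + 4) = ?A (5 * m + 4) (2 * m + 2)"
    using A2 by (intro num) simp_all

  have "real (num_min_ld_codes_path (5 * m + 1))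
        = 1 / 6 * real m ^ 3 + 2 * real m ^ 2 + 29 / 6 * real m + 1"
    unfolding C1 A3 of_nat_add card_completions_True_excess0 card_completions_True_excess1
    by (simp add: m power2_eq_square power3_eq_cube field_simps)
  moreover have "real (num_min_ld_codes_path (5 * m + 3))
        = 1 / 24 * real m ^ 4 + 11 / 12 * real m ^ 3 + 131 / 24 * real m ^ 2
          + 103 / 12 * real m + 3"
    unfolding C3 A4 of_nat_add card_completions_True_excess0 card_completions_True_excess1
      card_completions_True_excess2
    by (simp add: m power2_eq_square power3_eq_cube power4_eq_xxxx field_simps)
  moreover have "real (num_min_ld_codes_path (5 * m + 4))
        = 1 / 2 * real m ^ 2 + 7 / 2 * real m + 4"
    unfolding C4 A2 of_nat_add card_completions_True_excess0
    by (simp add: algebra_simps)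
  ultimately show ?thesis using C0 C2 by blast
qed

end
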